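(* Let $(\mathbf{P},d_{\mathbf{P}})$ be a finite metric poset and let $M,N$ be $\mathbf{P}$-modules. Then \[ \mathrm{dist}_{\mathrm{B}}\bigl(K^M_\bullet,K^N_\bullet\bigr)\ \le\ d^{\mathrm{Int}\overline{\mathbf{P}}}_{\mathrm{GT}}\bigl(K(M),K(N)\bigr)\ \le\ d^{\mathbf{P}}_{\mathrm{GT}}(M,N), \] where $K^M_\bullet$ and $K^N_\bullet$ are minimal projective resolutions of $K(M)$ and $K(N)$ in $\mathrm{vect}^{\mathrm{Int}\overline{\mathbf{P}}}$, and $\mathrm{dist}_{\mathrm{B}}$ is computed over the finite (extended) metric poset $(\mathrm{Int}\overline{\mathbf{P}},d_{\mathrm{Int}\overline{\mathbf{P}}})$.
   Context: Fix a field $k$; $\mathrm{vect}$ is the category of finite-dimensional $k$-vector spaces. Finite posets are categories with a unique morphism $x\to y$ iff $x\le y$; for a finite poset $\mathbf{S}$, an $\mathbf{S}$-module is a functor $\mathbf{S}\to\mathrm{vect}$, forming $\mathrm{vect}^{\mathbf{S}}$. For monotone $g$, $g^*$ is precomposition with $g$. A finite (extended) metric poset is a finite poset $\mathbf{S}$ with a (possibly extended, $[0,\infty]$-valued) metric $d_{\mathbf{S}}$. Augmentation and intervals: $\overline{\mathbf{P}}=\mathbf{P}\sqcup\{\top\}$ with $x<\top$ for all $x\in\mathbf{P}$; $d_{\overline{\mathbf{P}}}$ extends $d_{\mathbf{P}}$ by $d(x,\top)=d(\top,x)=\infty$ for $x\ne\top$, $d(\top,\top)=0$. For a finite poset $\mathbf{S}$,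 $\mathrm{Int}\,\mathbf{S}=\{(x,y)\in\mathbf{S}\times\mathbf{S}\mid x\le y\}$ with the product order and metric $d_{\mathrm{Int}\mathbf{S}}((x_1,y_1),(x_2,y_2))=\max\{d_{\mathbf{S}}(x_1,x_2),d_{\mathbf{S}}(y_1,y_2)\}$. For $M\in\mathrm{vect}^{\mathbf{P}}$, $\overline{M}\in\mathrm{vect}^{\overline{\mathbf{P}}}$ extends $M$ by $\overline{M}(\top)=0$. The kernel module $K(M)\in\mathrm{vect}^{\mathrm{Int}\overline{\mathbf{P}}}$ is $K(M)((x,y))=\ker\overline{M}(x\le y)$, with structure map for $(x_1,y_1)\le(x_2,y_2)$ the restriction of $\overline{M}(x_1\le x_2)$. Galois transport: a Galois insertion $f:\mathbf{Q}\rightleftarrows\mathbf{S}:g$ consists of monotone $f,g$ with $f(u)\le x\iff u\le g(x)$ and $f\circ g=\mathrm{id}_{\mathbf{S}}$. A Galois coupling of $(M,N)$ ($M,N\in\mathrm{vect}^{\mathbf{S}}$) is $(\mathbf{Q},f\dashv g,h\dashv i,\Gamma)$ with $\mathbf{Q}$ a finite poset, $f:\mathbf{Q}\rightleftarrows\mathbf{S}:g$, $h:\mathbf{Q}\rightleftarrows\mathbf{S}:i$ Galois insertions, $\Gamma\in\mathrm{vect}^{\mathbf{Q}}$, $g^*\Gamma\cong M$, $i^*\Gamma\cong N$; cost $=\sup_{q\in\mathbf{Q}}d_{\mathbf{S}}(f(q),h(q))$. $d^{\mathbf{S}}_{\mathrm{GT}}(M,N)$ is the infimum of costs of couplings ($\infty$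 if none). Bottleneck distance over $\mathbf{S}$: $k[\mathbf{S}]_x$ ($x\in\mathbf{S}$) is the module with value $k$ at $y\ge x$, $0$ elsewhere, identity maps; these are the indecomposable projectives. For $y\le x$, $\rho(x\ge y):k[\mathbf{S}]_x\to k[\mathbf{S}]_y$ is the canonical nonzero morphism (identity at each $z\ge x$), and $\rho(x\ge y)=0$ otherwise. A morphism between projectives $E=\bigoplus_{x\in\mathrm{smd}(E)}k[\mathbf{S}]_x\to F=\bigoplus_{y\in\mathrm{smd}(F)}k[\mathbf{S}]_y$ (given decompositions) is uniquely $[a_{x,y}\rho(x\ge y)]$ with $a_{x,y}\in k$, $a_{x,y}=0$ unless $x\ge y$; $\mathrm{Mat}$ is $[a_{x,y}]$. Projective resolutions $E_\bullet=(E_i,\partial_i:E_{i+1}\to E_i)_{i\ge0}$ are taken with fixed decompositions of each $E_i$; $|E_i|$ = number of summands. $\mathsf{Res}(P^M_\bullet,P^N_\bullet)$ = pairs of projective resolutions $(E_\bullet,F_\bullet)$ of $M,N$ with $|E_i|=|F_i|$ for all $i$. A matching is a family of bijections $B_i:\mathrm{smd}(E_i)\to\mathrm{smd}(F_i)$ with the $(x',x)$-entry of $\mathrm{Mat}(\partial^E_i)$ equal to the $(B_{i+1}(x'),B_i(x))$-entry of $\mathrm{Mat}(\partial^F_i)$ for all $i$, $x\in\mathrm{smd}(E_i)$, $x'\in\mathrm{smd}(E_{i+1})$; cost $=\sup_{i,x}d_{\mathbf{S}}(x,B_i(x))$. $\mathrm{dist}_{\mathrm{R}}(E_\bullet,F_\bullet)$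 = inf cost over matchings ($\infty$ if none); $\mathrm{dist}_{\mathrm{B}}(P^M_\bullet,P^N_\bullet)$ = inf of $\mathrm{dist}_{\mathrm{R}}$ over $\mathsf{Res}(P^M_\bullet,P^N_\bullet)$ ($\infty$ if empty), where $P^M_\bullet$ is a minimal projective resolution. *)

theory Defs
  imports Complex_Main "HOL-Library.Extended_Nonnegative_Real"
begin

text \<open>All vector spaces are realised as finite-dimensional subspaces of the ambient
  k-vector space nat => k (every finite-dimensional space embeds there).\<close>

type_synonym 'k vec = "nat \<Rightarrow> 'k"

definition vzero :: "'k::field vec" where "vzero = (\<lambda>_. 0)"
definition vadd :: "'k::field vec \<Rightarrow> 'k vec \<Rightarrow> 'k vec" where "vadd u v = (\<lambda>i. u i + v i)"
definition vsc :: "'k::field \<Rightarrow> 'k vec \<Rightarrow> 'k vec" where "vsc c v = (\<lambda>i. c * v i)"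

definition fdsub :: "'k::field vec set \<Rightarrow> bool" where
  "fdsub V \<longleftrightarrow> (\<exists>B. finite B \<and> B \<subseteq> V \<and>
      V = {v. \<exists>c. v = (\<lambda>i. \<Sum>b\<in>B. c b * b i)})"

definition linon :: "'k::field vec set \<Rightarrow> 'k vec set \<Rightarrow> ('k vec \<Rightarrow> 'k vec) \<Rightarrow> bool" where
  "linon V W f \<longleftrightarrow> (\<forall>v\<in>V. f v \<in> W) \<and>
     (\<forall>u\<in>V. \<forall>v\<in>V. f (vadd u v) = vadd (f u) (f v)) \<and>
     (\<forall>c. \<forall>v\<in>V. f (vsc c v) = vsc c (f v))"

definition fin_poset :: "'a set \<Rightarrow> ('a \<Rightarrow> 'a \<Rightarrow> bool) \<Rightarrow> bool" where
  "fin_poset S le \<longleftrightarrow> finite S \<and> (\<forall>x\<in>S. le x x) \<and>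
     (\<forall>x\<in>S. \<forall>y\<in>S. le x y \<and> le y x \<longrightarrow> x = y) \<and>
     (\<forall>x\<in>S. \<forall>y\<in>S. \<forall>z\<in>S. le x y \<and> le y z \<longrightarrow> le x z)"

definition ext_metric :: "'a set \<Rightarrow> ('a \<Rightarrow> 'a \<Rightarrow> ennreal) \<Rightarrow> bool" where
  "ext_metric S d \<longleftrightarrow> (\<forall>x\<in>S. \<forall>y\<in>S. d x y = 0 \<longleftrightarrow> x = y) \<and>
     (\<forall>x\<in>S. \<forall>y\<in>S. d x y = d y x) \<and>
     (\<forall>x\<in>S. \<forall>y\<in>S. \<forall>z\<in>S. d x z \<le> d x y + d y z)"

definition fin_metric :: "'a set \<Rightarrow> ('a \<Rightarrow> 'a \<Rightarrow> ennreal) \<Rightarrow> bool" where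
  "fin_metric S d \<longleftrightarrow> ext_metric S d \<and> (\<forall>x\<in>S. \<forall>y\<in>S. d x y < \<infinity>)"

type_synonym ('a, 'k) pmod = "('a \<Rightarrow> 'k vec set) \<times> ('a \<Rightarrow> 'a \<Rightarrow> 'k vec \<Rightarrow> 'k vec)"

definition is_module :: "'a set \<Rightarrow> ('a \<Rightarrow> 'a \<Rightarrow> bool) \<Rightarrow> ('a, 'k::field) pmod \<Rightarrow> bool" where
  "is_module S le M \<longleftrightarrow> (case M of (V, F) \<Rightarrow>
     (\<forall>x\<in>S. fdsub (V x)) \<and>
     (\<forall>x\<in>S. \<forall>y\<in>S. le x y \<longrightarrow> linon (V x) (V y) (F x y)) \<and>
     (\<forall>x\<in>S. \<forall>v\<in>V x. F x x v = v) \<and>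
     (\<forall>x\<in>S. \<forall>y\<in>S. \<forall>z\<in>S. le x y \<and> le y z \<longrightarrow> (\<forall>v\<in>V x. F y z (F x y v) = F x z v)))"

definition mod_iso :: "'a set \<Rightarrow> ('a \<Rightarrow> 'a \<Rightarrow> bool) \<Rightarrow> ('a, 'k::field) pmod \<Rightarrow> ('a, 'k) pmod \<Rightarrow> bool" where
  "mod_iso S le M N \<longleftrightarrow> (case M of (V, F) \<Rightarrow> case N of (W, G) \<Rightarrow>
     (\<exists>\<phi>. (\<forall>x\<in>S. linon (V x) (W x) (\<phi> x) \<and> bij_betw (\<phi> x) (V x) (W x)) \<and>
          (\<forall>x\<in>S. \<forall>y\<in>S. le x y \<longrightarrow> (\<forall>v\<in>V x. \<phi> y (F x y v) = G x y (\<phi> x v)))))"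

definition pullback :: "('a \<Rightarrow> 'b) \<Rightarrow> ('b, 'k) pmod \<Rightarrow> ('a, 'k) pmod" where
  "pullback g M = (case M of (V, F) \<Rightarrow> (\<lambda>x. V (g x), \<lambda>x y. F (g x) (g y)))"

definition galois_ins :: "'q set \<Rightarrow> ('q \<Rightarrow> 'q \<Rightarrow> bool) \<Rightarrow> 'a set \<Rightarrow> ('a \<Rightarrow> 'a \<Rightarrow> bool)
    \<Rightarrow> ('q \<Rightarrow> 'a) \<Rightarrow> ('a \<Rightarrow> 'q) \<Rightarrow> bool" where
  "galois_ins Q leQ S le f g \<longleftrightarrow>
     (\<forall>q\<in>Q. f q \<in> S) \<and> (\<forall>x\<in>S. g x \<in> Q) \<and>
     (\<forall>q\<in>Q. \<forall>q'\<in>Q. leQ q q' \<longrightarrow> le (f q) (f q')) \<and>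
     (\<forall>x\<in>S. \<forall>y\<in>S. le x y \<longrightarrow> leQ (g x) (g y)) \<and>
     (\<forall>q\<in>Q. \<forall>x\<in>S. le (f q) x \<longleftrightarrow> leQ q (g x)) \<and>
     (\<forall>x\<in>S. f (g x) = x)"

text \<open>Galois coupling of (M, N); the intermediate finite poset Q is realised on a
  subset of nat (every finite poset is isomorphic to one of these).\<close>
definition gt_coupling :: "'a set \<Rightarrow> ('a \<Rightarrow> 'a \<Rightarrow> bool) \<Rightarrow> ('a, 'k::field) pmod \<Rightarrow> ('a, 'k) pmod
    \<Rightarrow> nat set \<Rightarrow> (nat \<Rightarrow> nat \<Rightarrow> bool) \<Rightarrow> (nat \<Rightarrow> 'a) \<Rightarrow> ('a \<Rightarrow> nat) \<Rightarrow> (nat \<Rightarrow> 'a) \<Rightarrow> ('a \<Rightarrow> nat)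
    \<Rightarrow> (nat, 'k) pmod \<Rightarrow> bool" where
  "gt_coupling S le M N Q leQ f g h i \<Gamma> \<longleftrightarrow>
     fin_poset Q leQ \<and> galois_ins Q leQ S le f g \<and> galois_ins Q leQ S le h i \<and>
     is_module Q leQ \<Gamma> \<and> mod_iso S le (pullback g \<Gamma>) M \<and> mod_iso S le (pullback i \<Gamma>) N"

definition d_GT :: "'a set \<Rightarrow> ('a \<Rightarrow> 'a \<Rightarrow> bool) \<Rightarrow> ('a \<Rightarrow> 'a \<Rightarrow> ennreal)
    \<Rightarrow> ('a, 'k::field) pmod \<Rightarrow> ('a, 'k) pmod \<Rightarrow> ennreal" where
  "d_GT S le d M N = Inf {(SUP q\<in>Q. d (f q) (h q)) | Q leQ f g h i \<Gamma>.
      gt_coupling S le M N Q leQ f g h i \<Gamma>}"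

text \<open>Augmented poset: None plays the role of the new top element.\<close>
definition aug :: "'a set \<Rightarrow> 'a option set" where
  "aug P = insert None (Some ` P)"

fun aug_le :: "('a \<Rightarrow> 'a \<Rightarrow> bool) \<Rightarrow> 'a option \<Rightarrow> 'a option \<Rightarrow> bool" where
  "aug_le le (Some x) (Some y) = le x y"
| "aug_le le _ None = True"
| "aug_le le None (Some _) = False"

fun aug_d :: "('a \<Rightarrow> 'a \<Rightarrow> ennreal) \<Rightarrow> 'a option \<Rightarrow> 'a option \<Rightarrow> ennreal" where
  "aug_d d (Some x) (Some y) = d x y"
| "aug_d d None None = 0"
| "aug_d d _ _ = \<infinity>"

definition IntS :: "'a set \<Rightarrow> ('a \<Rightarrow> 'a \<Rightarrow> bool) \<Rightarrow> ('a \<times> 'a) set" where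
  "IntS S le = {(x, y). x \<in> S \<and> y \<in> S \<and> le x y}"

definition int_le :: "('a \<Rightarrow> 'a \<Rightarrow> bool) \<Rightarrow> 'a \<times> 'a \<Rightarrow> 'a \<times> 'a \<Rightarrow> bool" where
  "int_le le p q \<longleftrightarrow> le (fst p) (fst q) \<and> le (snd p) (snd q)"

definition int_d :: "('a \<Rightarrow> 'a \<Rightarrow> ennreal) \<Rightarrow> 'a \<times> 'a \<Rightarrow> 'a \<times> 'a \<Rightarrow> ennreal" where
  "int_d d p q = max (d (fst p) (fst q)) (d (snd p) (snd q))"

definition aug_mod :: "('a, 'k::field) pmod \<Rightarrow> ('a option, 'k) pmod" where
  "aug_mod M = (case M of (V, F) \<Rightarrow>
     (\<lambda>x. case x of None \<Rightarrow> {vzero} | Some a \<Rightarrow> V a,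
      \<lambda>x y. case (x, y) of (Some a, Some b) \<Rightarrow> F a b | _ \<Rightarrow> (\<lambda>_. vzero)))"

definition Kmod :: "('a, 'k::field) pmod \<Rightarrow> ('a option \<times> 'a option, 'k) pmod" where
  "Kmod M = (case aug_mod M of (V, F) \<Rightarrow>
     (\<lambda>p. {v \<in> V (fst p). F (fst p) (snd p) v = vzero},
      \<lambda>p q. F (fst p) (fst q)))"

text \<open>The projective module with chosen decomposition (summand list xs) is
  the direct sum of k[S]_(xs!j); its value at z is realised as the vectors supported on
  the indices j with xs!j <= z, with identity structure maps.\<close>
definition proj_val :: "('a \<Rightarrow> 'a \<Rightarrow> bool) \<Rightarrow> 'a list \<Rightarrow> 'a \<Rightarrow> 'k::field vec set" where
  "proj_val le xs z = {v. \<forall>j. v j \<noteq> 0 \<longrightarrow> j < length xs \<and> le (xs ! j) z}"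

text \<open>A matrix a (entry a j' j, from summand j' of the source to summand j of the target)
  defines a morphism of projectives iff a j' j = 0 unless xs'!j' >= xs!j.\<close>
definition valid_mat :: "('a \<Rightarrow> 'a \<Rightarrow> bool) \<Rightarrow> 'a list \<Rightarrow> 'a list \<Rightarrow> (nat \<Rightarrow> nat \<Rightarrow> 'k::field) \<Rightarrow> bool" where
  "valid_mat le xs' xs a \<longleftrightarrow> (\<forall>j' j. a j' j \<noteq> 0 \<longrightarrow>
      j' < length xs' \<and> j < length xs \<and> le (xs ! j) (xs' ! j'))"

definition mat_app :: "'a list \<Rightarrow> (nat \<Rightarrow> nat \<Rightarrow> 'k::field) \<Rightarrow> 'k vec \<Rightarrow> 'k vec" where
  "mat_app xs' a v = (\<lambda>j. \<Sum>j'<length xs'. v j' * a j' j)"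

text \<open>(xs, a, eps) is a projective resolution of M:
  E_i has summands xs i, the differential E_(i+1) -> E_i has matrix a i, and
  eps : E_0 -> M is the augmentation; ... -> E_1 -> E_0 -> M -> 0 is exact.\<close>
definition is_proj_res :: "'a set \<Rightarrow> ('a \<Rightarrow> 'a \<Rightarrow> bool) \<Rightarrow> ('a, 'k::field) pmod
    \<Rightarrow> (nat \<Rightarrow> 'a list) \<Rightarrow> (nat \<Rightarrow> nat \<Rightarrow> nat \<Rightarrow> 'k) \<Rightarrow> ('a \<Rightarrow> 'k vec \<Rightarrow> 'k vec) \<Rightarrow> bool" where
  "is_proj_res S le M xs a eps \<longleftrightarrow> (case M of (V, F) \<Rightarrow>
     (\<forall>i. set (xs i) \<subseteq> S) \<and>
     (\<forall>i. valid_mat le (xs (Suc i)) (xs i) (a i)) \<and>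
     (\<forall>z\<in>S. linon (proj_val le (xs 0) z) (V z) (eps z)) \<and>
     (\<forall>z\<in>S. \<forall>w\<in>S. le z w \<longrightarrow> (\<forall>v\<in>proj_val le (xs 0) z. eps w v = F z w (eps z v))) \<and>
     (\<forall>z\<in>S. eps z ` proj_val le (xs 0) z = V z) \<and>
     (\<forall>z\<in>S. {v \<in> proj_val le (xs 0) z. eps z v = vzero} =
             mat_app (xs 1) (a 0) ` proj_val le (xs 1) z) \<and>
     (\<forall>i. \<forall>z\<in>S. {v \<in> proj_val le (xs (Suc i)) z. mat_app (xs (Suc i)) (a i) v = vzero} =
             mat_app (xs (Suc (Suc i))) (a (Suc i)) ` proj_val le (xs (Suc (Suc i))) z))"

definition is_matching :: "(nat \<Rightarrow> 'a list) \<Rightarrow> (nat \<Rightarrow> nat \<Rightarrow> nat \<Rightarrow> 'k)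
    \<Rightarrow> (nat \<Rightarrow> 'a list) \<Rightarrow> (nat \<Rightarrow> nat \<Rightarrow> nat \<Rightarrow> 'k) \<Rightarrow> (nat \<Rightarrow> nat \<Rightarrow> nat) \<Rightarrow> bool" where
  "is_matching xs a ys b \<sigma> \<longleftrightarrow>
     (\<forall>i. bij_betw (\<sigma> i) {..<length (xs i)} {..<length (ys i)}) \<and>
     (\<forall>i j' j. j' < length (xs (Suc i)) \<longrightarrow> j < length (xs i) \<longrightarrow>
        a i j' j = b i (\<sigma> (Suc i) j') (\<sigma> i j))"

definition matching_cost :: "('a \<Rightarrow> 'a \<Rightarrow> ennreal) \<Rightarrow> (nat \<Rightarrow> 'a list) \<Rightarrow> (nat \<Rightarrow> 'a list)
    \<Rightarrow> (nat \<Rightarrow> nat \<Rightarrow> nat) \<Rightarrow> ennreal" where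
  "matching_cost d xs ys \<sigma> = (SUP i. SUP j\<in>{..<length (xs i)}. d (xs i ! j) (ys i ! \<sigma> i j))"

definition dist_R :: "('a \<Rightarrow> 'a \<Rightarrow> ennreal) \<Rightarrow> (nat \<Rightarrow> 'a list) \<Rightarrow> (nat \<Rightarrow> nat \<Rightarrow> nat \<Rightarrow> 'k)
    \<Rightarrow> (nat \<Rightarrow> 'a list) \<Rightarrow> (nat \<Rightarrow> nat \<Rightarrow> nat \<Rightarrow> 'k) \<Rightarrow> ennreal" where
  "dist_R d xs a ys b = Inf {matching_cost d xs ys \<sigma> | \<sigma>. is_matching xs a ys b \<sigma>}"

definition dist_B :: "'a set \<Rightarrow> ('a \<Rightarrow> 'a \<Rightarrow> bool) \<Rightarrow> ('a \<Rightarrow> 'a \<Rightarrow> ennreal)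
    \<Rightarrow> ('a, 'k::field) pmod \<Rightarrow> ('a, 'k) pmod \<Rightarrow> ennreal" where
  "dist_B S le d M N = Inf {dist_R d xs a ys b | xs a eps ys b eta.
      is_proj_res S le M xs a eps \<and> is_proj_res S le N ys b eta \<and>
      (\<forall>i. length (xs i) = length (ys i))}"

end

theory Submission
  imports Defs "HOL-Library.Function_Algebras"
begin

text \<open>Precomposition with the right adjoint of a Galois insertion is exact and sends the
  indecomposable projective at q to the one at f q, keeping the matrices of morphisms. Hence a
  projective resolution of the module in a coupling restricts to resolutions of both coupled
  modules with identical matrices; the identity matching between them costs at most the coupling.
  For the second inequality, augmentation, intervals and kernels are compatible with Galois insertions and with
  precomposition, so a coupling of M and N induces one of their kernel modules; the new top element
  is fixed by both left adjoints and does not increase the cost.\<close>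

section \<open>Finite-dimensional subspaces\<close>

lemma vadd_eq: "vadd u v = u + v"
  by (simp add: vadd_def plus_fun_def)

lemma vzero_eq: "vzero = 0"
  by (simp add: vzero_def zero_fun_def)

text \<open>Opens the theory of spans, independence and subspaces to vectors with pointwise
  operations.\<close>

interpretation vec: vector_space "vsc :: 'k::field \<Rightarrow> 'k vec \<Rightarrow> 'k vec"
  by unfold_locales (auto simp: vsc_def fun_eq_iff algebra_simps)

lemma sum_fun_apply: "(\<Sum>b\<in>B. f b) i = (\<Sum>b\<in>B. f b i)"
  for f :: "'b \<Rightarrow> 'c \<Rightarrow> 'd::comm_monoid_add"
  by (induction B rule: infinite_finite_induct) auto

text \<open>For a finite set the span consists exactly of the explicit combinations in
  \<open>fdsub\<close>, so finite-dimensionality can be handled through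
  \<open>vec.span\<close>.\<close>

lemma fdsub_iff_span: "fdsub V \<longleftrightarrow> (\<exists>B. finite B \<and> V = vec.span B)"
proof -
  have eq: "vec.span B = {v. \<exists>c. v = (\<lambda>i. \<Sum>b\<in>B. c b * b i)}" if "finite B"
    for B :: "'a vec set"
    using that by (auto simp: vec.span_finite sum_fun_apply vsc_def fun_eq_iff)
  show ?thesis
  proof
    assume "fdsub V"
    then obtain B where B: "finite B" "V = {v. \<exists>c. v = (\<lambda>i. \<Sum>b\<in>B. c b * b i)}"
      unfolding fdsub_def by blast
    then show "\<exists>B. finite B \<and> V = vec.span B"
      using eq[OF B(1)] by auto
  next
    assume "\<exists>B. finite B \<and> V = vec.span B"
    then obtain B where B: "finite B" "V = vec.span B" by blast
    show "fdsub V"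
      unfolding fdsub_def
      by (rule exI[of _ B]) (simp only: B(2) eq[OF B(1), symmetric] B(1) vec.span_superset simp_thms)
  qed
qed

lemma fdsub_subspace: "fdsub V \<Longrightarrow> vec.subspace V"
  by (auto simp: fdsub_iff_span vec.subspace_span)

text \<open>A maximal independent subset of \<open>U\<close> spans \<open>U\<close>, and it is
  finite because an independent set inside the span of a finite set is finite.\<close>

lemma fdsub_mono:
  assumes "fdsub V" "vec.subspace U" "U \<subseteq> V"
  shows "fdsub U"
proof -
  obtain T where T: "finite T" "V = vec.span T"
    using assms(1) by (auto simp: fdsub_iff_span)
  obtain B where B: "B \<subseteq> U" "vec.independent B" "U \<subseteq> vec.span B"
    using vec.maximal_independent_subset by blast
  have "finite B"
    using vec.independent_span_bound[OF T(1) B(2)] B(1) assms(3) T(2) by blast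
  moreover have "U = vec.span B"
    using B assms(2) by (simp add: subset_antisym vec.span_minimal)
  ultimately show ?thesis
    by (auto simp: fdsub_iff_span)
qed

text \<open>\<open>linon\<close> controls \<open>f\<close> only on the carrier \<open>V\<close>, so
  zero, sums, kernels and images are all treated relative to a subspace.\<close>

lemma linon_zero:
  assumes "linon V W f" "vec.subspace V"
  shows "f 0 = 0"
proof -
  have "f (vsc 0 0) = vsc 0 (f 0)"
    using assms(1) vec.subspace_0[OF assms(2)] unfolding linon_def by blast
  then show ?thesis by (simp only: vec.scale_zero_left)
qed

lemma linon_sum:
  assumes f: "linon V W f" and V: "vec.subspace V"
    and g: "\<And>i. i \<in> I \<Longrightarrow> g i \<in> V"
  shows "f (\<Sum>i\<in>I. g i) = (\<Sum>i\<in>I. f (g i))"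
  using g
proof (induction I rule: infinite_finite_induct)
  case (insert x I)
  then have "(\<Sum>i\<in>I. g i) \<in> V"
    by (intro vec.subspace_sum[OF V]) auto
  then have "f (g x + (\<Sum>i\<in>I. g i)) = f (g x) + f (\<Sum>i\<in>I. g i)"
    using f insert.prems by (simp only: linon_def vadd_eq) blast
  with insert show ?case
    by (simp only: sum.insert insert_iff simp_thms)
qed (simp_all add: linon_zero[OF f V])

lemma linon_kernel_subspace:
  assumes "linon V W f" "vec.subspace V"
  shows "vec.subspace {v \<in> V. f v = 0}"
  using assms linon_zero[OF assms]
  by (auto simp: vec.subspace_def linon_def vadd_eq)

lemma linon_image_subspace:
  assumes "linon V W f" "vec.subspace V"
  shows "vec.subspace (f ` V)"
proof -
  have add: "f u + f v = f (u + v)" and sc: "vsc c (f v) = f (vsc c v)"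
    if "u \<in> V" "v \<in> V" for u v c
    using assms(1) that by (auto simp: linon_def vadd_eq)
  show ?thesis
    using assms(2) linon_zero[OF assms] add sc
    by (auto simp: vec.subspace_def)
qed

text \<open>The unit vectors at all indices below \<open>length xs\<close> span a possibly larger
  space; the value at \<open>z\<close> is a subspace of it, which suffices by
  \<open>fdsub_mono\<close>.\<close>

lemma fdsub_proj_val: "fdsub (proj_val le xs z :: 'k::field vec set)"
proof -
  define e :: "nat \<Rightarrow> 'k vec" where "e j = (\<lambda>i. if i = j then 1 else 0)" for j
  have "v \<in> vec.span (e ` {..<length xs})" if "v \<in> proj_val le xs z" for v :: "'k vec"
  proof -
    have "v = (\<Sum>j<length xs. vsc (v j) (e j))"
      using that by (auto simp: fun_eq_iff sum_fun_apply vsc_def e_def proj_val_def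
          if_distrib[of "\<lambda>x. _ * x"] cong: if_cong)
    also have "\<dots> \<in> vec.span (e ` {..<length xs})"
      by (intro vec.span_sum vec.span_scale vec.span_base) auto
    finally show ?thesis .
  qed
  moreover have "vec.subspace (proj_val le xs z :: 'k vec set)"
    by (auto simp: vec.subspace_def proj_val_def vsc_def) (metis add.right_neutral)+
  moreover have "fdsub (vec.span (e ` {..<length xs}))"
    unfolding fdsub_iff_span by blast
  ultimately show ?thesis
    by (meson fdsub_mono subsetI)
qed

text \<open>Row \<open>a j\<close> is the image of the \<open>j\<close>-th generator of the source,
  so a matrix acts as a linear combination of its rows.\<close>

lemma mat_app_sum: "mat_app xs a v = (\<Sum>j<length xs. vsc (v j) (a j))"
  by (auto simp: mat_app_def fun_eq_iff sum_fun_apply vsc_def)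

lemma linon_lincomb:
  assumes "\<And>v. v \<in> A \<Longrightarrow> (\<Sum>j<n. vsc (v j) (b j)) \<in> W"
  shows "linon A W (\<lambda>v. \<Sum>j<n. vsc (v j) (b j))"
  using assms
  by (auto simp: linon_def vadd_eq vec.scale_left_distrib sum.distrib vec.scale_sum_right)
    (simp add: vsc_def)

section \<open>Projective resolutions\<close>

lemma proj_val_mono:
  assumes "fin_poset S le" "set xs \<subseteq> S" "z \<in> S" "w \<in> S" "le z w"
  shows "proj_val le xs z \<subseteq> proj_val le xs w"
proof -
  have "le (xs ! j) w" if "j < length xs" "le (xs ! j) z" for j
    using that assms nth_mem[OF that(1)] unfolding fin_poset_def by blast
  then show ?thesis by (auto simp: proj_val_def)
qed

text \<open>By Yoneda, a morphism from k[S]_x to a module amounts to an element of its value at x.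
  One summand is taken for each vector of a finite spanning set of each \<open>V x\<close>; the
  resulting epimorphism is in general not minimal.\<close>

lemma projective_cover:
  assumes S: "fin_poset S le" and M: "is_module S le (V, F)"
  obtains ys b where
    "set ys \<subseteq> S" and
    "\<And>j. j < length ys \<Longrightarrow> b j \<in> V (ys ! j)" and
    "\<And>z. z \<in> S \<Longrightarrow> linon (proj_val le ys z) (V z) (\<lambda>v. \<Sum>j<length ys. vsc (v j) (F (ys ! j) z (b j)))" and
    "\<And>z. z \<in> S \<Longrightarrow> (\<lambda>v. \<Sum>j<length ys. vsc (v j) (F (ys ! j) z (b j))) ` proj_val le ys z = V z" and
    "\<And>z w v. z \<in> S \<Longrightarrow> w \<in> S \<Longrightarrow> le z w \<Longrightarrow> v \<in> proj_val le ys z \<Longrightarrow>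
      (\<Sum>j<length ys. vsc (v j) (F (ys ! j) w (b j))) =
      F z w (\<Sum>j<length ys. vsc (v j) (F (ys ! j) z (b j)))"
proof -
  have V: "fdsub (V x)" if "x \<in> S" for x
    using M that by (simp add: is_module_def)
  have F: "linon (V x) (V y) (F x y)" if "x \<in> S" "y \<in> S" "le x y" for x y
    using M that by (simp add: is_module_def)
  have Fid: "F x x v = v" if "x \<in> S" "v \<in> V x" for x v
    using M that by (simp add: is_module_def)
  have Fcomp: "F y z (F x y v) = F x z v"
    if "x \<in> S" "y \<in> S" "z \<in> S" "le x y" "le y z" "v \<in> V x" for x y z v
    using M that unfolding is_module_def by blast
  have "\<forall>x\<in>S. \<exists>B. finite B \<and> V x = vec.span B"
    using V by (simp add: fdsub_iff_span)
  then obtain B where B: "\<And>x. x \<in> S \<Longrightarrow> finite (B x)" "\<And>x. x \<in> S \<Longrightarrow> V x = vec.span (B x)"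
    by metis
  have "finite (Sigma S B)"
    using S B by (auto simp: fin_poset_def)
  then obtain gs where gs: "set gs = Sigma S B"
    using finite_list by blast
  define ys where "ys = map fst gs"
  define b where "b j = snd (gs ! j)" for j
  have ysS: "ys ! j \<in> S" and bB: "b j \<in> B (ys ! j)" if "j < length ys" for j
    using that gs nth_mem[of j gs] by (auto simp: ys_def b_def)
  have bV: "b j \<in> V (ys ! j)" if "j < length ys" for j
    using bB[OF that] B(2)[OF ysS[OF that]] vec.span_base by blast
  \<comment> \<open>When \<open>ys ! j\<close> is not below \<open>z\<close>, nothing is known about
    \<open>F (ys ! j) z\<close>, but then the coefficient \<open>v j\<close> vanishes.\<close>
  have mem: "vsc (v j) (F (ys ! j) z (b j)) \<in> V z"
    if "z \<in> S" "v \<in> proj_val le ys z" "j < length ys" for z v j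
  proof (cases "v j = 0")
    case True
    then show ?thesis using fdsub_subspace[OF V[OF that(1)]] by (simp add: vec.subspace_0)
  next
    case False
    then have "le (ys ! j) z" using that by (auto simp: proj_val_def)
    then have "F (ys ! j) z (b j) \<in> V z"
      using F[OF ysS[OF that(3)] that(1)] bV[OF that(3)] by (auto simp: linon_def)
    then show ?thesis using fdsub_subspace[OF V[OF that(1)]] by (simp add: vec.subspace_scale)
  qed
  define eps where "eps z v = (\<Sum>j<length ys. vsc (v j) (F (ys ! j) z (b j)))" for z v
  have lin: "linon (proj_val le ys z) (V z) (eps z)" if "z \<in> S" for z
    unfolding eps_def using mem[OF that] fdsub_subspace[OF V[OF that]]
    by (intro linon_lincomb) (auto intro: vec.subspace_sum)
  have onto: "eps z ` proj_val le ys z = V z" if z: "z \<in> S" for z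
  proof
    show "eps z ` proj_val le ys z \<subseteq> V z"
      using lin[OF z] by (auto simp: linon_def)
    have "x \<in> eps z ` proj_val le ys z" if x: "x \<in> B z" for x
    proof -
      obtain j where j: "j < length gs" "gs ! j = (z, x)"
        using gs x z by (metis SigmaI in_set_conv_nth)
      \<comment> \<open>The generator of the summand belonging to \<open>(z, x)\<close>; it is
        present at \<open>z\<close> by reflexivity and maps to \<open>F z z x\<close>, that is, to
        \<open>x\<close>.\<close>
      define e :: "'b vec" where "e = (\<lambda>i. if i = j then 1 else 0)"
      have "e \<in> proj_val le ys z"
        using j S z by (auto simp: proj_val_def e_def ys_def fin_poset_def)
      moreover have "eps z e = x"
      proof -
        have "eps z e = (\<Sum>i<length ys. if i = j then F (ys ! i) z (b i) else 0)"
          unfolding eps_def e_def by (intro sum.cong) auto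
        also have "\<dots> = F z z x"
          using j by (simp add: ys_def b_def)
        also have "\<dots> = x"
          using Fid[OF z] B(2)[OF z] x vec.span_base by blast
        finally show ?thesis .
      qed
      ultimately show ?thesis by blast
    qed
    \<comment> \<open>The image is a subspace, so it is enough that it contains the spanning set
      \<open>B z\<close>.\<close>
    then show "V z \<subseteq> eps z ` proj_val le ys z"
      unfolding B(2)[OF z]
      by (intro vec.span_minimal subsetI
          linon_image_subspace[OF lin[OF z] fdsub_subspace[OF fdsub_proj_val]])
  qed
  have nat: "eps w v = F z w (eps z v)"
    if zw: "z \<in> S" "w \<in> S" "le z w" and v: "v \<in> proj_val le ys z" for z w v
  proof -
    have "F z w (eps z v) = (\<Sum>j<length ys. F z w (vsc (v j) (F (ys ! j) z (b j))))"
      unfolding eps_def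
      by (intro linon_sum[OF F[OF zw] fdsub_subspace[OF V[OF zw(1)]]] mem[OF zw(1) v]) auto
    also have "\<dots> = eps w v"
      unfolding eps_def
    proof (intro sum.cong refl)
      fix j assume "j \<in> {..<length ys}"
      then have j: "j < length ys" by simp
      show "F z w (vsc (v j) (F (ys ! j) z (b j))) = vsc (v j) (F (ys ! j) w (b j))"
      proof (cases "v j = 0")
        case True
        then show ?thesis
          using linon_zero[OF F[OF zw] fdsub_subspace[OF V[OF zw(1)]]] by simp
      next
        case False
        then have le: "le (ys ! j) z" using v by (auto simp: proj_val_def)
        then have "F (ys ! j) z (b j) \<in> V z"
          using F[OF ysS[OF j] zw(1)] bV[OF j] by (auto simp: linon_def)
        then show ?thesis
          using F[OF zw] Fcomp[OF ysS[OF j] zw(1,2) le zw(3) bV[OF j]]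
          by (auto simp: linon_def)
      qed
    qed
    finally show ?thesis by simp
  qed
  show ?thesis
    using that[of ys b] ysS bV lin onto nat unfolding eps_def
    by (auto simp: in_set_conv_nth subset_iff)
qed

text \<open>Structure maps of the projective are inclusions, so its submodules are increasing
  families of subspaces. The kernels to be resolved have this shape.\<close>

definition submod :: "'a set \<Rightarrow> ('a \<Rightarrow> 'a \<Rightarrow> bool) \<Rightarrow> 'a list \<Rightarrow> ('a \<Rightarrow> 'k::field vec set) \<Rightarrow> bool" where
  "submod S le xs U \<longleftrightarrow> (\<forall>z\<in>S. vec.subspace (U z) \<and> U z \<subseteq> proj_val le xs z) \<and>
     (\<forall>z\<in>S. \<forall>w\<in>S. le z w \<longrightarrow> U z \<subseteq> U w)"

text \<open>With identity structure maps the submodule is itself a module. The generators of its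
  cover are vectors of the ambient projective and become the rows of the matrix.\<close>

lemma submod_cover:
  fixes U :: "'a \<Rightarrow> 'k::field vec set"
  assumes S: "fin_poset S le" and U: "submod S le xs U"
  obtains ys a where "set ys \<subseteq> S" "valid_mat le ys xs a"
    "\<And>z. z \<in> S \<Longrightarrow> U z = mat_app ys a ` proj_val le ys z"
proof -
  have "is_module S le (U, \<lambda>_ _ v. v)"
    using U fdsub_mono[OF fdsub_proj_val[of le xs]]
    unfolding is_module_def submod_def linon_def by blast
  then obtain ys b where
    ys: "set ys \<subseteq> S" and b: "\<And>j. j < length ys \<Longrightarrow> b j \<in> U (ys ! j)" and
    onto: "\<And>z. z \<in> S \<Longrightarrow> (\<lambda>v. \<Sum>j<length ys. vsc (v j) (b j)) ` proj_val le ys z = U z"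
    by (rule projective_cover[OF S]) (rule that; simp)
  \<comment> \<open>Rows beyond the summands are set to 0, as \<open>valid_mat\<close> requires; its
    order condition holds since \<open>b j'\<close> lies in the projective at
    \<open>ys ! j'\<close>.\<close>
  define a where "a j' j = (if j' < length ys then b j' j else 0)" for j' j
  have "valid_mat le ys xs a"
    unfolding valid_mat_def
  proof (intro allI impI)
    fix j' j assume nz: "a j' j \<noteq> 0"
    then have j': "j' < length ys" by (auto simp: a_def split: if_splits)
    moreover have "b j' \<in> proj_val le xs (ys ! j')"
      using b[OF j'] U ys j' unfolding submod_def by (meson nth_mem subset_iff)
    ultimately show "j' < length ys \<and> j < length xs \<and> le (xs ! j) (ys ! j')"
      using nz by (auto simp: proj_val_def a_def)
  qed
  moreover have "mat_app ys a v = (\<Sum>j<length ys. vsc (v j) (b j))" for v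
    unfolding mat_app_sum by (intro sum.cong) (auto simp: a_def fun_eq_iff vsc_def)
  ultimately show ?thesis
    by (intro that[of ys a]) (simp_all add: ys onto)
qed

text \<open>Naturality enters only as preservation of zeros along inclusions, which fits both the
  augmentation and a matrix; the latter acts alike at every point.\<close>

lemma submod_kernel:
  assumes S: "fin_poset S le" and xs: "set xs \<subseteq> S"
    and lin: "\<And>z. z \<in> S \<Longrightarrow> linon (proj_val le xs z) (W z) (f z)"
    and nat: "\<And>z w v. z \<in> S \<Longrightarrow> w \<in> S \<Longrightarrow> le z w \<Longrightarrow> v \<in> proj_val le xs z \<Longrightarrow>
      f z v = 0 \<Longrightarrow> f w v = 0"
  shows "submod S le xs (\<lambda>z. {v \<in> proj_val le xs z. f z v = 0})"
  using linon_kernel_subspace[OF lin fdsub_subspace[OF fdsub_proj_val]]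
    proj_val_mono[OF S xs] nat
  unfolding submod_def by blast

lemma submod_mat_kernel:
  assumes S: "fin_poset S le" and xs: "set xs \<subseteq> S"
  shows "submod S le xs (\<lambda>z. {v \<in> proj_val le xs z. mat_app xs a v = 0})"
  \<comment> \<open>Only the kernel matters, so the whole ambient space serves as codomain.\<close>
  by (rule submod_kernel[OF S xs, where W = "\<lambda>_. UNIV"])
    (auto simp: mat_app_sum[abs_def] intro: linon_lincomb)

text \<open>Cover \<open>M\<close>, then the kernel of the augmentation, then by dependent choice
  the kernel of each differential in turn.\<close>

lemma proj_res_exists:
  fixes M :: "('a, 'k::field) pmod"
  assumes S: "fin_poset S le" and M: "is_module S le M"
  obtains xs a eps where "is_proj_res S le M xs a eps"
proof -
  obtain V F where VF: "M = (V, F)" by (cases M)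
  obtain xs0 b where
    xs0: "set xs0 \<subseteq> S" and
    E: "\<And>z. z \<in> S \<Longrightarrow> linon (proj_val le xs0 z) (V z) (\<lambda>v. \<Sum>j<length xs0. vsc (v j) (F (xs0 ! j) z (b j)))"
      "\<And>z. z \<in> S \<Longrightarrow> (\<lambda>v. \<Sum>j<length xs0. vsc (v j) (F (xs0 ! j) z (b j))) ` proj_val le xs0 z = V z"
      "\<And>z w v. z \<in> S \<Longrightarrow> w \<in> S \<Longrightarrow> le z w \<Longrightarrow> v \<in> proj_val le xs0 z \<Longrightarrow>
      (\<Sum>j<length xs0. vsc (v j) (F (xs0 ! j) w (b j))) =
      F z w (\<Sum>j<length xs0. vsc (v j) (F (xs0 ! j) z (b j)))"
    by (rule projective_cover[OF S M[unfolded VF]]) (rule that; assumption)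
  define eps where "eps z v = (\<Sum>j<length xs0. vsc (v j) (F (xs0 ! j) z (b j)))" for z v
  note E = E[folded eps_def]
  have F0: "F z w 0 = 0" if "z \<in> S" "w \<in> S" "le z w" for z w
    using M that linon_zero[OF _ fdsub_subspace, of "V z" "V w" "F z w"]
    by (simp add: is_module_def VF)
  have "submod S le xs0 (\<lambda>z. {v \<in> proj_val le xs0 z. eps z v = 0})"
    by (rule submod_kernel[OF S xs0, where W = V]) (auto simp: E F0)
  then obtain xs1 a0 where
    xs1: "set xs1 \<subseteq> S" "valid_mat le xs1 xs0 a0"
    and ex0: "\<And>z. z \<in> S \<Longrightarrow> {v \<in> proj_val le xs0 z. eps z v = 0} = mat_app xs1 a0 ` proj_val le xs1 z"
    by (rule submod_cover[OF S]) (rule that; blast)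
  \<comment> \<open>A state holds a differential with its target list, source list and matrix; the
    clause for \<open>n = 0\<close> pins the start to the cover of the kernel of
    \<open>eps\<close>.\<close>
  define good :: "nat \<Rightarrow> 'a list \<times> 'a list \<times> (nat \<Rightarrow> nat \<Rightarrow> 'k) \<Rightarrow> bool" where
    "good n = (\<lambda>(xs, ys, a). set xs \<subseteq> S \<and> set ys \<subseteq> S \<and> valid_mat le ys xs a \<and>
       (n = 0 \<longrightarrow> xs = xs0 \<and> ys = xs1 \<and> a = a0))" for n
  \<comment> \<open>The source of one differential is the target of the next, and the sequence is
    exact there.\<close>
  define nxt :: "'a list \<times> 'a list \<times> (nat \<Rightarrow> nat \<Rightarrow> 'k) \<Rightarrow> 'a list \<times> 'a list \<times> (nat \<Rightarrow> nat \<Rightarrow> 'k) \<Rightarrow> bool" where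
    "nxt = (\<lambda>(xs, ys, a) (ys', zs, c). ys' = ys \<and> (\<forall>z\<in>S.
       {v \<in> proj_val le ys z. mat_app ys a v = 0} = mat_app zs c ` proj_val le zs z))"
  have "\<exists>s. \<forall>n. good n (s n) \<and> nxt (s n) (s (Suc n))"
  proof (rule dependent_nat_choice)
    show "\<exists>t. good 0 t"
      using xs0 xs1 by (auto simp: good_def)
  next
    fix t n assume t: "good n t"
    obtain xs ys a where teq: "t = (xs, ys, a)" by (cases t)
    then have ys: "set ys \<subseteq> S" using t by (simp add: good_def)
    obtain zs c where "set zs \<subseteq> S" "valid_mat le zs ys c"
      "\<And>z. z \<in> S \<Longrightarrow> {v \<in> proj_val le ys z. mat_app ys a v = 0} = mat_app zs c ` proj_val le zs z"
      by (rule submod_cover[OF S submod_mat_kernel[OF S ys, of a]]) (rule that; blast)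
    then have "good (Suc n) (ys, zs, c) \<and> nxt t (ys, zs, c)"
      using ys by (simp add: good_def nxt_def teq)
    then show "\<exists>u. good (Suc n) u \<and> nxt t u" by blast
  qed
  then obtain s where s: "\<And>n. good n (s n)" "\<And>n. nxt (s n) (s (Suc n))" by blast
  define xs where "xs n = fst (s n)" for n
  define a where "a n = snd (snd (s n))" for n
  \<comment> \<open>The overlap of consecutive states lets a single sequence \<open>xs\<close>
    supply both lists.\<close>
  have s_eq: "s n = (xs n, xs (Suc n), a n)" for n
    using s(2)[of n] by (auto simp: nxt_def xs_def a_def split: prod.splits)
  have g: "set (xs n) \<subseteq> S" "valid_mat le (xs (Suc n)) (xs n) (a n)" for n
    using s(1)[of n] by (auto simp: s_eq good_def)
  have st: "xs 0 = xs0" "xs (Suc 0) = xs1" "a 0 = a0"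
    using s(1)[of 0] by (auto simp: s_eq good_def)
  have ex: "{v \<in> proj_val le (xs (Suc n)) z. mat_app (xs (Suc n)) (a n) v = 0} =
    mat_app (xs (Suc (Suc n))) (a (Suc n)) ` proj_val le (xs (Suc (Suc n))) z" if "z \<in> S" for n z
    using s(2)[of n] that by (simp add: s_eq nxt_def)
  have "is_proj_res S le M xs a eps"
    unfolding is_proj_res_def VF by (simp add: g st E ex0 ex vzero_eq)
  then show ?thesis using that by blast
qed

section \<open>Transport along Galois insertions\<close>

text \<open>The adjunction says that k[Q]_q pulled back along \<open>g\<close> is k[S]_x for x =
  \<open>f q\<close>; in coordinates this is an equality.\<close>

lemma proj_val_galois:
  assumes "galois_ins Q leQ S le f g" "set xs \<subseteq> Q" "z \<in> S"
  shows "proj_val le (map f xs) z = proj_val leQ xs (g z)"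
proof -
  have "le (f (xs ! j)) z \<longleftrightarrow> leQ (xs ! j) (g z)" if "j < length xs" for j
    using assms nth_mem[OF that] unfolding galois_ins_def by blast
  then show ?thesis by (auto simp: proj_val_def)
qed

text \<open>Exactness is tested pointwise, hence survives evaluation at the points
  \<open>g z\<close>. Summands move by \<open>f\<close> and matrices stay; only the augmentation
  changes, being composed with the isomorphism onto \<open>M\<close>.\<close>

lemma proj_res_galois:
  assumes gal: "galois_ins Q leQ S le f g" and \<Gamma>: "is_module Q leQ \<Gamma>"
    and iso: "mod_iso S le (pullback g \<Gamma>) M" and res: "is_proj_res Q leQ \<Gamma> xs a eps"
  obtains eta where "is_proj_res S le M (\<lambda>i. map f (xs i)) a eta"
proof -
  obtain V F where VF: "\<Gamma> = (V, F)" by (cases \<Gamma>)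
  obtain W G where WG: "M = (W, G)" by (cases M)
  obtain \<phi> where iso:
    "\<forall>x\<in>S. linon (V (g x)) (W x) (\<phi> x) \<and> bij_betw (\<phi> x) (V (g x)) (W x)"
    "\<forall>x\<in>S. \<forall>y\<in>S. le x y \<longrightarrow>
       (\<forall>v\<in>V (g x). \<phi> y (F (g x) (g y) v) = G x y (\<phi> x v))"
    using iso unfolding mod_iso_def pullback_def VF WG by auto
  have \<phi>: "linon (V (g x)) (W x) (\<phi> x)" "bij_betw (\<phi> x) (V (g x)) (W x)"
    "y \<in> S \<Longrightarrow> le x y \<Longrightarrow> v \<in> V (g x) \<Longrightarrow> \<phi> y (F (g x) (g y) v) = G x y (\<phi> x v)"
    if "x \<in> S" for x y v
    using iso that by blast+
  have fS: "f q \<in> S" if "q \<in> Q" for q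
    using gal that unfolding galois_ins_def by blast
  have fmono: "le (f q) (f r)" if "q \<in> Q" "r \<in> Q" "leQ q r" for q r
    using gal that unfolding galois_ins_def by blast
  have gQ: "g x \<in> Q" if "x \<in> S" for x
    using gal that unfolding galois_ins_def by blast
  have gmono: "leQ (g x) (g y)" if "x \<in> S" "y \<in> S" "le x y" for x y
    using gal that unfolding galois_ins_def by blast
  have xsQ: "set (xs i) \<subseteq> Q" for i
    using res by (simp add: is_proj_res_def VF)
  note pv = proj_val_galois[OF gal xsQ]
  \<comment> \<open>A matrix sees its source list only through the length, so relabelling summands
    is invisible to it.\<close>
  have ma: "mat_app (map f l) = mat_app l" for l
    by (simp add: mat_app_def fun_eq_iff)
  have epslin: "linon (proj_val leQ (xs 0) q) (V q) (eps q)" if "q \<in> Q" for q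
    using res that by (simp add: is_proj_res_def VF)
  have V0: "vec.subspace (V q)" if "q \<in> Q" for q
    using \<Gamma> that by (intro fdsub_subspace) (simp add: is_module_def VF)
  have ker: "\<phi> z v = 0 \<longleftrightarrow> v = 0" if "z \<in> S" "v \<in> V (g z)" for z v
    using \<phi>(2)[OF that(1)] linon_zero[OF \<phi>(1)[OF that(1)] V0[OF gQ[OF that(1)]]] that
      vec.subspace_0[OF V0[OF gQ[OF that(1)]]]
    by (metis bij_betw_inv_into_left)
  define eta where "eta z v = \<phi> z (eps (g z) v)" for z v
  have epsV: "eps (g z) v \<in> V (g z)" if "z \<in> S" "v \<in> proj_val leQ (xs 0) (g z)" for z v
    using epslin[OF gQ[OF that(1)]] that by (simp add: linon_def)
  have 1: "valid_mat le (map f (xs (Suc i))) (map f (xs i)) (a i)" for i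
  proof -
    have "valid_mat leQ (xs (Suc i)) (xs i) (a i)"
      using res by (simp add: is_proj_res_def VF)
    then show ?thesis
      using fmono xsQ[of i] xsQ[of "Suc i"] by (auto simp: valid_mat_def subset_iff)
  qed
  have 2: "linon (proj_val leQ (xs 0) (g z)) (W z) (eta z)" if "z \<in> S" for z
    using epslin[OF gQ[OF that]] \<phi>(1)[OF that] unfolding linon_def eta_def by simp
  have 3: "eta w v = G z w (eta z v)"
    if "z \<in> S" "w \<in> S" "le z w" "v \<in> proj_val leQ (xs 0) (g z)" for z w v
  proof -
    have "eps (g w) v = F (g z) (g w) (eps (g z) v)"
      using res gQ gmono that by (simp add: is_proj_res_def VF)
    then show ?thesis
      using \<phi>(3)[OF that(1-3) epsV[OF that(1,4)]] by (simp add: eta_def)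
  qed
  have 4: "eta z ` proj_val leQ (xs 0) (g z) = W z" if "z \<in> S" for z
  proof -
    have "eps (g z) ` proj_val leQ (xs 0) (g z) = V (g z)"
      using res gQ that by (simp add: is_proj_res_def VF)
    then show ?thesis
      using \<phi>(2)[OF that] by (auto simp: eta_def bij_betw_def simp flip: image_image)
  qed
  have 5: "{v \<in> proj_val leQ (xs 0) (g z). eta z v = vzero} =
    mat_app (xs 1) (a 0) ` proj_val leQ (xs 1) (g z)" if "z \<in> S" for z
  proof -
    have "{v \<in> proj_val leQ (xs 0) (g z). eps (g z) v = vzero} =
      mat_app (xs 1) (a 0) ` proj_val leQ (xs 1) (g z)"
      using res gQ that by (simp add: is_proj_res_def VF)
    moreover have "{v \<in> proj_val leQ (xs 0) (g z). eps (g z) v = vzero} =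
      {v \<in> proj_val leQ (xs 0) (g z). eta z v = vzero}"
      using ker[OF that epsV[OF that]] by (auto simp: eta_def vzero_eq)
    ultimately show ?thesis by simp
  qed
  have 6: "{v \<in> proj_val leQ (xs (Suc i)) (g z). mat_app (xs (Suc i)) (a i) v = vzero} =
    mat_app (xs (Suc (Suc i))) (a (Suc i)) ` proj_val leQ (xs (Suc (Suc i))) (g z)"
    if "z \<in> S" for i z
    using res gQ that by (simp add: is_proj_res_def VF)
  have "is_proj_res S le M (\<lambda>i. map f (xs i)) a eta"
    unfolding is_proj_res_def WG prod.case ma
    using 1 2 3 4 5 6 xsQ fS by (auto simp: pv subset_iff)
  then show ?thesis using that by blast
qed

theorem dist_B_le_d_GT: "dist_B S le d M N \<le> d_GT S le d M N"
  unfolding d_GT_def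
proof (rule Inf_greatest, clarify)
  fix Q leQ f g h i \<Gamma>
  assume c: "gt_coupling S le M N Q leQ f g h i \<Gamma>"
  then have Q: "fin_poset Q leQ" and \<Gamma>: "is_module Q leQ \<Gamma>"
    and gf: "galois_ins Q leQ S le f g" and gh: "galois_ins Q leQ S le h i"
    and isoM: "mod_iso S le (pullback g \<Gamma>) M" and isoN: "mod_iso S le (pullback i \<Gamma>) N"
    by (auto simp: gt_coupling_def)
  obtain xs a eps where res: "is_proj_res Q leQ \<Gamma> xs a eps"
    using proj_res_exists[OF Q \<Gamma>] .
  obtain \<epsilon> \<eta> where E: "is_proj_res S le M (\<lambda>i. map f (xs i)) a \<epsilon>"
    and F: "is_proj_res S le N (\<lambda>i. map h (xs i)) a \<eta>"
    using proj_res_galois[OF gf \<Gamma> isoM res] proj_res_galois[OF gh \<Gamma> isoN res] by metis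
  have xsQ: "xs n ! j \<in> Q" if "j < length (xs n)" for n j
    using res nth_mem[OF that] by (auto simp: is_proj_res_def split: prod.splits)
  \<comment> \<open>The infimum runs over all pairs of resolutions with equal numbers of summands,
    including nonminimal ones.\<close>
  have "dist_B S le d M N \<le> dist_R d (\<lambda>i. map f (xs i)) a (\<lambda>i. map h (xs i)) a"
    unfolding dist_B_def 
    by (intro Inf_lower CollectI exI conjI) (rule refl E F | simp)+
  \<comment> \<open>Both resolutions carry the matrices \<open>a\<close>, so the identity on indices
    is a matching.\<close>
  also have "\<dots> \<le> matching_cost d (\<lambda>i. map f (xs i)) (\<lambda>i. map h (xs i)) (\<lambda>_ j. j)"
    unfolding dist_R_def 
    by (intro Inf_lower CollectI exI conjI, rule refl) (simp add: is_matching_def bij_betw_def)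
  also have "\<dots> \<le> (SUP q\<in>Q. d (f q) (h q))"
    unfolding matching_cost_def by (auto intro!: SUP_least SUP_upper2[OF xsQ])
  finally show "dist_B S le d M N \<le> (SUP q\<in>Q. d (f q) (h q))" .
qed

section \<open>Kernel modules\<close>

text \<open>Both extended maps send exactly \<open>None\<close> to \<open>None\<close>, so
  comparisons with the top agree on the two sides of the adjunction.\<close>

lemma galois_ins_aug:
  assumes "galois_ins Q leQ S le f g"
  shows "galois_ins (aug Q) (aug_le leQ) (aug S) (aug_le le) (map_option f) (map_option g)"
  using assms unfolding galois_ins_def aug_def by auto

text \<open>Monotonicity sends intervals to intervals, and the adjunction holds in each
  endpoint.\<close>

lemma galois_ins_Int:
  assumes "galois_ins Q leQ S le f g"
  shows "galois_ins (IntS Q leQ) (int_le leQ) (IntS S le) (int_le le) (map_prod f f) (map_prod g g)"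
  using assms unfolding galois_ins_def IntS_def int_le_def by auto

lemma fin_poset_aug:
  assumes "fin_poset S le"
  shows "fin_poset (aug S) (aug_le le)"
proof -
  have trans: "le x z" if "x \<in> S" "y \<in> S" "z \<in> S" "le x y" "le y z" for x y z
    using assms that unfolding fin_poset_def by blast
  have antisym: "x = y" if "x \<in> S" "y \<in> S" "le x y" "le y x" for x y
    using assms that unfolding fin_poset_def by blast
  have refl: "le x x" if "x \<in> S" for x
    using assms that unfolding fin_poset_def by blast
  have "aug_le le x z"
    if "x \<in> aug S" "y \<in> aug S" "z \<in> aug S" "aug_le le x y" "aug_le le y z" for x y z
    using that trans[of "the x" "the y" "the z"]
    by (cases x; cases y; cases z) (auto simp: aug_def)
  moreover have "x = y" if "x \<in> aug S" "y \<in> aug S" "aug_le le x y" "aug_le le y x" for x y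
    using that antisym[of "the x" "the y"] by (cases x; cases y) (auto simp: aug_def)
  moreover have "aug_le le x x" if "x \<in> aug S" for x
    using that refl by (cases x) (auto simp: aug_def)
  moreover have "finite (aug S)"
    using assms by (simp add: aug_def fin_poset_def)
  ultimately show ?thesis
    unfolding fin_poset_def by blast
qed

lemma fin_poset_Int:
  assumes "fin_poset S le"
  shows "fin_poset (IntS S le) (int_le le)"
proof -
  have trans: "le x z" if "x \<in> S" "y \<in> S" "z \<in> S" "le x y" "le y z" for x y z
    using assms that unfolding fin_poset_def by blast
  have antisym: "x = y" if "x \<in> S" "y \<in> S" "le x y" "le y x" for x y
    using assms that unfolding fin_poset_def by blast
  have refl: "le x x" if "x \<in> S" for x
    using assms that unfolding fin_poset_def by blast
  have "finite S" using assms by (simp add: fin_poset_def)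
  then have "finite (IntS S le)"
    by (intro finite_subset[OF _ finite_cartesian_product[of S S]]) (auto simp: IntS_def)
  moreover have "int_le le p r"
    if "p \<in> IntS S le" "q \<in> IntS S le" "r \<in> IntS S le" "int_le le p q" "int_le le q r" for p q r
    using that trans[of "fst p" "fst q" "fst r"] trans[of "snd p" "snd q" "snd r"]
    by (auto simp: IntS_def int_le_def)
  moreover have "p = q"
    if "p \<in> IntS S le" "q \<in> IntS S le" "int_le le p q" "int_le le q p" for p q
    using that antisym[of "fst p" "fst q"] antisym[of "snd p" "snd q"]
    by (auto simp: IntS_def int_le_def)
  moreover have "int_le le p p" if "p \<in> IntS S le" for p
    using that refl by (auto simp: IntS_def int_le_def)
  ultimately show ?thesis
    unfolding fin_poset_def by blast
qed

section \<open>Augmented modules and kernel modules\<close>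

lemma is_module_aug:
  assumes "is_module S le M"
  shows "is_module (aug S) (aug_le le) (aug_mod M)"
proof -
  obtain V F where VF: "M = (V, F)" by (cases M)
  have "fdsub {vzero :: 'b vec}"
    unfolding fdsub_iff_span vzero_eq by (rule exI[of _ "{}"]) auto
  moreover have "vzero \<in> V x" if "x \<in> S" for x
    using assms that fdsub_subspace[of "V x"] by (auto simp: is_module_def VF vzero_eq vec.subspace_0)
  moreover have "F x y vzero = vzero" if "x \<in> S" "y \<in> S" "le x y" for x y
    using assms that linon_zero[of "V x" "V y" "F x y"] fdsub_subspace[of "V x"]
    by (auto simp: is_module_def VF vzero_eq)
  ultimately show ?thesis
    using assms unfolding is_module_def VF aug_mod_def aug_def
    by (auto simp: linon_def vadd_def vsc_def vzero_def)
qed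

text \<open>The kernel construction over any poset, separated from augmentation so that the two can
  be studied independently.\<close>

definition ker_mod :: "('a, 'k::field) pmod \<Rightarrow> ('a \<times> 'a, 'k) pmod" where
  "ker_mod M = (\<lambda>p. {v \<in> fst M (fst p). snd M (fst p) (snd p) v = vzero},
     \<lambda>p q. snd M (fst p) (fst q))"

lemma Kmod_eq: "Kmod M = ker_mod (aug_mod M)"
  by (simp add: Kmod_def ker_mod_def split: prod.split)

lemma pullback_ker_mod: "ker_mod (pullback g M) = pullback (map_prod g g) (ker_mod M)"
  by (simp add: ker_mod_def pullback_def split: prod.split)

lemma pullback_aug_mod: "aug_mod (pullback g M) = pullback (map_option g) (aug_mod M)"
  by (auto simp: aug_mod_def pullback_def fun_eq_iff split: prod.split option.split)

lemma pullback_pullback: "pullback g (pullback h M) = pullback (h \<circ> g) M"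
  by (simp add: pullback_def split: prod.split)

text \<open>Pullback merely renames indices of pointwise constructions, hence an equality and not
  only an isomorphism. It makes \<open>Kmod \<Gamma>\<close> the coupling module for the kernel
  modules.\<close>

lemma pullback_Kmod:
  "pullback (map_prod (map_option g) (map_option g)) (Kmod M) = Kmod (pullback g M)"
  by (simp add: Kmod_eq pullback_ker_mod pullback_aug_mod)

lemma is_module_ker:
  assumes "fin_poset S le" and M: "is_module S le M"
  shows "is_module (IntS S le) (int_le le) (ker_mod M)"
proof -
  obtain V F where VF: "M = (V, F)" by (cases M)
  have V: "fdsub (V x)" if "x \<in> S" for x
    using M that by (simp add: is_module_def VF)
  have F: "linon (V x) (V y) (F x y)" if "x \<in> S" "y \<in> S" "le x y" for x y
    using M that by (simp add: is_module_def VF)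
  have Fid: "F x x v = v" if "x \<in> S" "v \<in> V x" for x v
    using M that by (simp add: is_module_def VF)
  have Fcomp: "F y z (F x y v) = F x z v"
    if "x \<in> S" "y \<in> S" "z \<in> S" "le x y" "le y z" "v \<in> V x" for x y z v
    using M that unfolding is_module_def VF by blast
  have F0: "F x y 0 = 0" if "x \<in> S" "y \<in> S" "le x y" for x y
    using linon_zero[OF F[OF that] fdsub_subspace[OF V]] that by blast
  have 1: "fdsub {v \<in> V x. F x y v = 0}" if "x \<in> S" "y \<in> S" "le x y" for x y
    using fdsub_mono[OF V[OF that(1)] linon_kernel_subspace[OF F[OF that] fdsub_subspace[OF V]]]
      that by blast
  \<comment> \<open>The paths from \<open>x\<close> to \<open>y'\<close> through \<open>x'\<close>
    and through \<open>y\<close> agree, and the second kills \<open>v\<close> at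
    \<open>y\<close>.\<close>
  have 2: "F x' y' (F x x' v) = 0"
    if "x \<in> S" "y \<in> S" "x' \<in> S" "y' \<in> S" "le x y" "le x' y'" "le x x'" "le y y'" "v \<in> V x"
      "F x y v = 0" for x y x' y' v
    using that Fcomp[of x x' y' v] Fcomp[of x y y' v] F0[of y y'] by simp
  show ?thesis
    unfolding is_module_def ker_mod_def VF IntS_def int_le_def vzero_eq
    using 1 2 F Fid Fcomp by (auto simp: linon_def)
qed

lemma is_module_Kmod:
  "fin_poset S le \<Longrightarrow> is_module S le M \<Longrightarrow>
    is_module (IntS (aug S) (aug_le le)) (int_le (aug_le le)) (Kmod M)"
  unfolding Kmod_eq by (intro is_module_ker fin_poset_aug is_module_aug)

lemma mod_iso_aug:
  assumes "mod_iso S le M N"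
  shows "mod_iso (aug S) (aug_le le) (aug_mod M) (aug_mod N)"
proof -
  obtain V F where VF: "M = (V, F)" by (cases M)
  obtain W G where WG: "N = (W, G)" by (cases N)
  obtain \<phi> where
    \<phi>: "\<forall>x\<in>S. linon (V x) (W x) (\<phi> x) \<and> bij_betw (\<phi> x) (V x) (W x)"
       "\<forall>x\<in>S. \<forall>y\<in>S. le x y \<longrightarrow> (\<forall>v\<in>V x. \<phi> y (F x y v) = G x y (\<phi> x v))"
    using assms unfolding mod_iso_def VF WG by auto
  show ?thesis
    unfolding mod_iso_def VF WG aug_mod_def prod.case
    by (rule exI[of _ "\<lambda>x. case x of None \<Rightarrow> (\<lambda>v. v) | Some a \<Rightarrow> \<phi> a"])
      (use \<phi> in \<open>auto simp: aug_def linon_def vadd_def vsc_def vzero_def bij_betw_def\<close>)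
qed

text \<open>The isomorphism at the left endpoint restricts to kernels, by naturality and injectivity
  at the right endpoint.\<close>

lemma mod_iso_ker:
  assumes M: "is_module S le M" and iso: "mod_iso S le M N"
  shows "mod_iso (IntS S le) (int_le le) (ker_mod M) (ker_mod N)"
proof -
  obtain V F where VF: "M = (V, F)" by (cases M)
  obtain W G where WG: "N = (W, G)" by (cases N)
  obtain \<phi> where iso:
    "\<forall>x\<in>S. linon (V x) (W x) (\<phi> x) \<and> bij_betw (\<phi> x) (V x) (W x)"
    "\<forall>x\<in>S. \<forall>y\<in>S. le x y \<longrightarrow> (\<forall>v\<in>V x. \<phi> y (F x y v) = G x y (\<phi> x v))"
    using iso unfolding mod_iso_def VF WG by auto
  have lin: "linon (V x) (W x) (\<phi> x)" and bij: "bij_betw (\<phi> x) (V x) (W x)"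
    and nat: "y \<in> S \<Longrightarrow> le x y \<Longrightarrow> v \<in> V x \<Longrightarrow> \<phi> y (F x y v) = G x y (\<phi> x v)"
    if "x \<in> S" for x y v
    using iso that by blast+
  have V: "vec.subspace (V x)" if "x \<in> S" for x
    using M that by (intro fdsub_subspace) (simp add: is_module_def VF)
  have F: "F x y v \<in> V y" if "x \<in> S" "y \<in> S" "le x y" "v \<in> V x" for x y v
    using M that by (simp add: is_module_def VF linon_def)
  have zero: "\<phi> x v = 0 \<longleftrightarrow> v = 0" if "x \<in> S" "v \<in> V x" for x v
    using bij[OF that(1)] linon_zero[OF lin[OF that(1)] V[OF that(1)]] that
      vec.subspace_0[OF V[OF that(1)]]
    by (metis bij_betw_inv_into_left)
  have ker: "G x y (\<phi> x v) = 0 \<longleftrightarrow> F x y v = 0" if "x \<in> S" "y \<in> S" "le x y" "v \<in> V x" for x y v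
    using nat[OF that] zero[OF that(2) F[OF that]] by simp
  have "bij_betw (\<phi> x) {v \<in> V x. F x y v = 0} {v \<in> W x. G x y v = 0}"
    if "x \<in> S" "y \<in> S" "le x y" for x y
  proof -
    have "W x = \<phi> x ` V x" "inj_on (\<phi> x) (V x)"
      using bij[OF that(1)] by (auto simp: bij_betw_def)
    then show ?thesis
      using ker[OF that] by (auto simp: bij_betw_def inj_on_def)
  qed
  then show ?thesis
    unfolding mod_iso_def ker_mod_def VF WG prod.case fst_conv snd_conv vzero_eq
    by (intro exI[of _ "\<lambda>p. \<phi> (fst p)"])
      (use lin ker nat in \<open>auto simp: IntS_def int_le_def linon_def\<close>)
qed

lemma mod_iso_Kmod:
  "is_module S le M \<Longrightarrow> mod_iso S le M N \<Longrightarrow>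
    mod_iso (IntS (aug S) (aug_le le)) (int_le (aug_le le)) (Kmod M) (Kmod N)"
  unfolding Kmod_eq by (intro mod_iso_ker mod_iso_aug is_module_aug)

section \<open>Couplings of kernel modules\<close>

lemma is_module_pullback:
  assumes "galois_ins Q leQ S le f g" "is_module Q leQ \<Gamma>"
  shows "is_module S le (pullback g \<Gamma>)"
  using assms unfolding is_module_def pullback_def galois_ins_def by (auto split: prod.splits)

text \<open>\<open>gt_coupling\<close> requires a poset of natural numbers. Encoding by
  \<open>to_nat\<close> admits any countable carrier type, in particular pairs of optional naturals,
  where the intervals live.\<close>

lemma d_GT_le_coupling:
  fixes Q :: "'q::countable set"
  assumes Q: "fin_poset Q leQ" and gf: "galois_ins Q leQ S le f g" and gh: "galois_ins Q leQ S le h i"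
    and \<Gamma>: "is_module Q leQ \<Gamma>"
    and isoM: "mod_iso S le (pullback g \<Gamma>) M" and isoN: "mod_iso S le (pullback i \<Gamma>) N"
  shows "d_GT S le d M N \<le> (SUP q\<in>Q. d (f q) (h q))"
proof -
  define leR where "leR m n = leQ (from_nat m) (from_nat n)" for m n :: nat
  have "fin_poset (to_nat ` Q) leR"
    using Q by (simp only: fin_poset_def leR_def ball_simps from_nat_to_nat inj_eq[OF inj_to_nat]
        finite_imageI simp_thms) (elim conjE, intro conjI)
  moreover have "galois_ins (to_nat ` Q) leR S le (f \<circ> from_nat) (to_nat \<circ> g)"
    "galois_ins (to_nat ` Q) leR S le (h \<circ> from_nat) (to_nat \<circ> i)"
    using gf gh unfolding galois_ins_def leR_def by auto
  moreover have "is_module (to_nat ` Q) leR (pullback from_nat \<Gamma>)"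
    using \<Gamma> unfolding is_module_def leR_def pullback_def by (auto split: prod.splits)
  \<comment> \<open>By this cancellation the pullbacks of the encoded module are the original
    ones.\<close>
  moreover have "from_nat \<circ> (to_nat \<circ> j) = j" for j :: "'a \<Rightarrow> 'q"
    by (simp add: fun_eq_iff)
  ultimately have "gt_coupling S le M N (to_nat ` Q) leR (f \<circ> from_nat) (to_nat \<circ> g)
      (h \<circ> from_nat) (to_nat \<circ> i) (pullback from_nat \<Gamma>)"
    using isoM isoN by (simp add: gt_coupling_def pullback_pullback)
  then have "d_GT S le d M N \<le> (SUP q\<in>to_nat ` Q. d ((f \<circ> from_nat) q) ((h \<circ> from_nat) q))"
    unfolding d_GT_def by (intro Inf_lower) blast
  then show ?thesis by (simp add: image_image)
qed

theorem d_GT_Kmod_le: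
  "d_GT (IntS (aug S) (aug_le le)) (int_le (aug_le le)) (int_d (aug_d d)) (Kmod M) (Kmod N)
    \<le> d_GT S le d M N" (is "?l \<le> _")
  unfolding d_GT_def[of S]
proof (rule Inf_greatest, clarify)
  fix Q leQ f g h i \<Gamma>
  assume "gt_coupling S le M N Q leQ f g h i \<Gamma>"
  then have Q: "fin_poset Q leQ" and \<Gamma>: "is_module Q leQ \<Gamma>"
    and gf: "galois_ins Q leQ S le f g" and gh: "galois_ins Q leQ S le h i"
    and isoM: "mod_iso S le (pullback g \<Gamma>) M" and isoN: "mod_iso S le (pullback i \<Gamma>) N"
    by (auto simp: gt_coupling_def)
  have "?l \<le> (SUP q\<in>IntS (aug Q) (aug_le leQ). int_d (aug_d d)
      (map_prod (map_option f) (map_option f) q) (map_prod (map_option h) (map_option h) q))"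
    by (rule d_GT_le_coupling[OF fin_poset_Int[OF fin_poset_aug[OF Q]]
          galois_ins_Int[OF galois_ins_aug[OF gf]] galois_ins_Int[OF galois_ins_aug[OF gh]]
          is_module_Kmod[OF Q \<Gamma>]])
      (simp_all add: pullback_Kmod mod_iso_Kmod isoM isoN
        is_module_pullback[OF gf \<Gamma>] is_module_pullback[OF gh \<Gamma>])
  also have "\<dots> \<le> (SUP q\<in>Q. d (f q) (h q))"
    \<comment> \<open>An endpoint \<open>None\<close> is fixed by both maps and contributes 0; any
      other contributes some \<open>d (f q) (h q)\<close>. The infinite value of a mixed pair never
      arises.\<close>
    by (rule SUP_least) (auto simp: IntS_def aug_def int_d_def intro: SUP_upper)
  finally show "?l \<le> (SUP q\<in>Q. d (f q) (h q))" .
qed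

theorem theorem6p14:
  fixes P :: "'a set" and le :: "'a \<Rightarrow> 'a \<Rightarrow> bool" and d :: "'a \<Rightarrow> 'a \<Rightarrow> ennreal"
    and M N :: "('a, 'k::field) pmod"
  assumes "fin_poset P le" and "fin_metric P d"
    and "is_module P le M" and "is_module P le N"
  shows "dist_B (IntS (aug P) (aug_le le)) (int_le (aug_le le)) (int_d (aug_d d)) (Kmod M) (Kmod N)
           \<le> d_GT (IntS (aug P) (aug_le le)) (int_le (aug_le le)) (int_d (aug_d d)) (Kmod M) (Kmod N)
       \<and> d_GT (IntS (aug P) (aug_le le)) (int_le (aug_le le)) (int_d (aug_d d)) (Kmod M) (Kmod N)
           \<le> d_GT P le d M N"
  using dist_B_le_d_GT d_GT_Kmod_le by blast

end
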